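(* For every nonnegative integer $n$ let $$R_n=\sum_{k=0}^{n}\binom{n+k}{2k}\binom{2k}{k}\frac{1}{2k-1}.$$ Let $n$ be a positive integer and $p$ an odd prime. Then $$\sum_{k=0}^{n-1}(2k+1)R_k^2 \equiv 0 \pmod{n},$$ and $$\sum_{k=0}^{p-1}(2k+1)R_k^2 \equiv 4p(-1)^{\frac{p-1}{2}} -p^2 \pmod{p^3}.$$
   Context: For every nonnegative integer $k$, $\binom{2k}{k}\frac{1}{2k-1}$ is an integer, so each $R_n$ is an integer. *)

theory Defs
  imports "HOL-Number_Theory.Number_Theory"
begin

(* The numbers R_n are defined as integers so that congruences between them make sense
   (on the field of rationals, mod is trivial).  The div below is an exact division:
   odd_dvd_central_binomial proves this, and of_int_R identifies R n with the rational sum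
   of the source.  The divisor is an integer, so for k = 0 it is -1, and the term is -1. *)

definition R :: "nat \<Rightarrow> int" where
  "R n = (\<Sum>k=0..n. int ((n + k) choose (2 * k)) *
            (int ((2 * k) choose k) div (2 * int k - 1)))"

lemma odd_dvd_central_binomial: "2 * int k - 1 dvd int ((2 * k) choose k)"
proof (cases k)
  case 0
  then show ?thesis by simp
next
  case (Suc m)
  define B where "B = Suc (2 * m) choose Suc m"
  have "Suc m * B = Suc (2 * m) * ((2 * m) choose m)"
    unfolding B_def using Suc_times_binomial_eq[of "2 * m" m] by (simp only: mult.commute)
  then have "Suc (2 * m) dvd Suc m * B"
    by (simp only: dvd_triv_left)
  moreover have "coprime (Suc (2 * m)) (Suc m)"
  proof (rule coprimeI)
    fix d assume "d dvd Suc (2 * m)" "d dvd Suc m"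
    then have "d dvd 2 * Suc m - Suc (2 * m)"
      using dvd_diff_nat dvd_mult by blast
    then show "is_unit d" by simp
  qed
  ultimately have "Suc (2 * m) dvd B"
    by (simp only: coprime_dvd_mult_right_iff)
  moreover have "(2 * k) choose k = 2 * B"
    using binomial_symmetric[of m "Suc (2 * m)"] by (simp add: Suc B_def)
  ultimately have "int (Suc (2 * m)) dvd int ((2 * k) choose k)"
    by (simp only: int_dvd_int_iff dvd_mult)
  moreover have "int (Suc (2 * m)) = 2 * int k - 1"
    by (simp add: Suc)
  ultimately show ?thesis by (simp only:)
qed

lemma of_int_R:
  "rat_of_int (R n) = (\<Sum>k=0..n. of_nat ((n + k) choose (2 * k)) * of_nat ((2 * k) choose k) *
                         (1 / (2 * of_nat k - 1)))"
proof -
  have "rat_of_int (int ((2 * k) choose k) div (2 * int k - 1)) =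
          of_nat ((2 * k) choose k) / (2 * of_nat k - 1)" for k
    by (simp add: odd_dvd_central_binomial of_int_div)
  then show ?thesis
    by (simp add: R_def)
qed

end

theory Submission
  imports Defs
begin

text \<open>
  The central Delannoy numbers \<open>D\<^sub>n = P\<^sub>n(3)\<close> turn the numbers \<open>R\<^sub>n\<close> into the solution of a first-order
  recurrence, \<open>(2n+1) R\<^sub>n\<^sub>+\<^sub>1 = (2n+3) R\<^sub>n + D\<^sub>n\<^sub>+\<^sub>1 + D\<^sub>n\<close>. Together with the Legendre recurrence for
  \<open>D\<^sub>n\<close>, it gives a closed form: \<open>8 (2n+1)\<^sup>2\<close> times the sum over \<open>k < n\<close> is \<open>n\<close> times a quadratic form
  in \<open>R\<^sub>n\<close>, \<open>D\<^sub>n\<close>, \<open>D\<^sub>n\<^sub>-\<^sub>1\<close> whose coefficients are polynomials in \<open>n\<close>. As \<open>2n+1\<close> is prime to \<open>n\<close>,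
  only the power of 2 obstructs divisibility by \<open>n\<close>; for even \<open>n\<close> the form is divisible by 8,
  because all the numbers involved are odd. For \<open>n = p\<close> the closed form modulo \<open>p\<^sup>3\<close> needs
  only \<open>D\<^sub>p\<close> modulo \<open>p\<close>, and \<open>D\<^sub>p + D\<^sub>p\<^sub>-\<^sub>1\<close> and \<open>R\<^sub>p + D\<^sub>p\<close> modulo \<open>p\<^sup>2\<close>. The terms of the last sum are
  proportional to \<open>2k/(2k-1)\<close>; modulo \<open>p\<^sup>2\<close> those for \<open>k\<close> and \<open>p+1-k\<close> cancel, which leaves
  \<open>k = 1\<close>, \<open>k = p\<close> and \<open>k = (p+1)/2\<close>.
\<close>

section \<open>Shifted Legendre coefficients and the recurrence of the central Delannoy
  numbers\<close>

text \<open>The coefficient of \<open>x\<^sup>k\<close> in the shifted Legendre polynomial \<open>P\<^sub>n(1 + 2x)\<close>.\<close>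

definition legendre_coeff :: "nat \<Rightarrow> nat \<Rightarrow> int" where
  "legendre_coeff n k = int ((n + k) choose (2 * k)) * int ((2 * k) choose k)"

definition delannoy :: "nat \<Rightarrow> int" where
  "delannoy n = (\<Sum>k=0..n. legendre_coeff n k)"

lemma legendre_coeff_0 [simp]: "legendre_coeff n 0 = 1"
  by (simp add: legendre_coeff_def)

lemma legendre_coeff_eq_0: "n < k \<Longrightarrow> legendre_coeff n k = 0"
  by (simp add: legendre_coeff_def)

text \<open>This form exhibits the factor \<open>n choose k\<close>, which a prime \<open>n\<close>
  divides for 0 < k < n.\<close>

lemma legendre_coeff_eq: "legendre_coeff n k = int (n choose k) * int ((n + k) choose k)"
proof (cases "k \<le> n")
  case True
  have "((n + k) choose (2 * k)) * ((2 * k) choose k) = ((n + k) choose k) * (n choose k)"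
    using choose_mult[of k "2 * k" "n + k"] True by (simp add: mult_2)
  then show ?thesis
    unfolding legendre_coeff_def by (metis of_nat_mult mult.commute)
qed (simp add: legendre_coeff_eq_0)

lemma Suc_Suc_choose_mult:
  "(n + 2 choose (k + 2)) * ((k + 2) * (k + 1)) = (n + 2) * (n + 1) * (n choose k)"
  using Suc_times_binomial_eq[of "Suc n" "Suc k"] Suc_times_binomial_eq[of n k]
  by (simp add: algebra_simps)

lemma legendre_coeff_Suc_Suc:
  "(int k + 1)\<^sup>2 * legendre_coeff (Suc n) (Suc k) = (int n + int k + 2) * (int n + int k + 1) * legendre_coeff n k"
proof -
  define A B where "A = int ((n + k + 2) choose (2 * k + 2))" and "B = int ((2 * k + 2) choose (k + 1))"
  define a b where "a = int ((n + k) choose (2 * k))" and "b = int ((2 * k) choose k)"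
  have A: "A * ((2 * int k + 2) * (2 * int k + 1)) = (int n + int k + 2) * (int n + int k + 1) * a"
    using arg_cong[OF Suc_Suc_choose_mult[of "n + k" "2 * k"], of int]
    by (simp add: A_def a_def algebra_simps)
  have B: "(int k + 1)\<^sup>2 * B = (2 * int k + 2) * (2 * int k + 1) * b"
  proof -
    have "Suc k * ((2 * k + 2) choose Suc k) = (2 * k + 2) * ((2 * k + 1) choose k)"
      using Suc_times_binomial_eq[of "2 * k + 1" k] by (simp add: mult.commute)
    moreover have "Suc k * ((2 * k + 1) choose k) = (2 * k + 1) * ((2 * k) choose k)"
      using Suc_times_binomial_eq[of "2 * k" k] binomial_symmetric[of k "2 * k + 1"]
      by (simp add: mult.commute)
    ultimately have "Suc k * (Suc k * ((2 * k + 2) choose Suc k)) = (2 * k + 2) * ((2 * k + 1) * ((2 * k) choose k))"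
      by (metis mult.left_commute)
    from arg_cong[OF this, of int] show ?thesis
      by (simp add: B_def b_def power2_eq_square algebra_simps)
  qed
  have "((2 * int k + 2) * (2 * int k + 1)) * ((int k + 1)\<^sup>2 * (A * B))
      = (A * ((2 * int k + 2) * (2 * int k + 1))) * ((int k + 1)\<^sup>2 * B)"
    by (simp only: ac_simps)
  also have "\<dots> = ((2 * int k + 2) * (2 * int k + 1)) * ((int n + int k + 2) * (int n + int k + 1) * (a * b))"
    unfolding A B by (simp only: ac_simps)
  finally have "(int k + 1)\<^sup>2 * (A * B) = (int n + int k + 2) * (int n + int k + 1) * (a * b)"
    by simp
  then show ?thesis
    by (simp add: A_def B_def a_def b_def legendre_coeff_def)
qed

lemma legendre_coeff_Suc:
  "(int n + 1 - int k) * legendre_coeff (Suc n) k = (int n + 1 + int k) * legendre_coeff n k"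
proof (cases "k \<le> n")
  case True
  have "(n + k + 1) * ((n + k) choose (2 * k)) = (n + k + 1 - 2 * k) * ((n + k + 1) choose (2 * k))"
    using binomial_absorb_comp[of "n + k + 1" "2 * k"] by simp
  also have "n + k + 1 - 2 * k = n + 1 - k"
    using True by simp
  finally have "int (n + k + 1) * int ((n + k) choose (2 * k)) = int (n + 1 - k) * int ((n + k + 1) choose (2 * k))"
    by (metis of_nat_mult)
  moreover have "int (n + 1 - k) = int n + 1 - int k" "int (n + k + 1) = int n + 1 + int k"
    using True by simp_all
  ultimately have "(int n + 1 - int k) * int ((Suc n + k) choose (2 * k)) = (int n + 1 + int k) * int ((n + k) choose (2 * k))"
    by (metis add_Suc Suc_eq_plus1)
  then show ?thesis
    unfolding legendre_coeff_def mult.assoc[symmetric] by (simp only:)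
next
  case False
  then show ?thesis
    by (cases "k = Suc n") (simp_all add: legendre_coeff_eq_0)
qed

text \<open>Legendre's differential equation read off coefficientwise. The ratio in k is the
  diagonal ratio followed by a step back in n; the factor n + k + 2 cancelled at the end is
  positive.\<close>

lemma legendre_coeff_Suc_right:
  "(int k + 1)\<^sup>2 * legendre_coeff n (Suc k) = (int n - int k) * (int n + int k + 1) * legendre_coeff n k"
proof -
  have eq: "(int n - int k) * legendre_coeff (Suc n) (Suc k) = (int n + int k + 2) * legendre_coeff n (Suc k)"
    using legendre_coeff_Suc[of n "Suc k"] by (simp add: algebra_simps)
  have "(int n + int k + 2) * ((int k + 1)\<^sup>2 * legendre_coeff n (Suc k))
      = (int n - int k) * ((int k + 1)\<^sup>2 * legendre_coeff (Suc n) (Suc k))"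
    by (simp only: mult.left_commute[of _ "(int k + 1)\<^sup>2"] eq)
  also have "\<dots> = (int n + int k + 2) * ((int n - int k) * (int n + int k + 1) * legendre_coeff n k)"
    unfolding legendre_coeff_Suc_Suc by (simp only: ac_simps)
  finally show ?thesis
    by simp
qed

text \<open>This is the coefficient of x^(k+1) in the three-term Legendre recurrence at the argument
  1 + 2x; the right-hand side comes from the part 2x. After multiplication by (k+1)^2 all terms are
  multiples of \<open>legendre_coeff (n + 1) k\<close>.\<close>

lemma legendre_coeff_recurrence:
  "(int n + 2) * legendre_coeff (n + 2) (Suc k) - (2 * int n + 3) * legendre_coeff (n + 1) (Suc k)
     + (int n + 1) * legendre_coeff n (Suc k) = 2 * (2 * int n + 3) * legendre_coeff (n + 1) k"
proof -
  define X where "X = legendre_coeff (n + 1) k"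
  have 1: "(int k + 1)\<^sup>2 * legendre_coeff (n + 2) (Suc k) = (int n + int k + 3) * (int n + int k + 2) * X"
    using legendre_coeff_Suc_Suc[of k "n + 1"] by (simp add: X_def algebra_simps)
  have 2: "(int k + 1)\<^sup>2 * legendre_coeff (n + 1) (Suc k) = (int n + 1 - int k) * (int n + int k + 2) * X"
    using legendre_coeff_Suc_right[of k "n + 1"] by (simp add: X_def algebra_simps)
  have 3: "(int k + 1)\<^sup>2 * legendre_coeff n (Suc k) = (int n - int k) * (int n + 1 - int k) * X"
  proof -
    have "(int k + 1)\<^sup>2 * legendre_coeff n (Suc k) = (int n - int k) * ((int n + 1 + int k) * legendre_coeff n k)"
      unfolding legendre_coeff_Suc_right by (simp only: ac_simps)
    also have "\<dots> = (int n - int k) * (int n + 1 - int k) * X"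
      unfolding legendre_coeff_Suc[symmetric] by (simp add: X_def mult.assoc)
    finally show ?thesis .
  qed
  have "(int k + 1)\<^sup>2 * ((int n + 2) * legendre_coeff (n + 2) (Suc k)
         - (2 * int n + 3) * legendre_coeff (n + 1) (Suc k) + (int n + 1) * legendre_coeff n (Suc k))
      = (int n + 2) * ((int k + 1)\<^sup>2 * legendre_coeff (n + 2) (Suc k))
         - (2 * int n + 3) * ((int k + 1)\<^sup>2 * legendre_coeff (n + 1) (Suc k))
         + (int n + 1) * ((int k + 1)\<^sup>2 * legendre_coeff n (Suc k))"
    by (simp add: algebra_simps power_numeral_reduce)
  also have "\<dots> = (int k + 1)\<^sup>2 * (2 * (2 * int n + 3) * X)"
    unfolding 1 2 3 by (simp add: algebra_simps power_numeral_reduce)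
  finally show ?thesis
    unfolding X_def by simp
qed

lemma delannoy_eq_sum: "n \<le> m \<Longrightarrow> delannoy n = (\<Sum>k=0..m. legendre_coeff n k)"
  unfolding delannoy_def by (rule sum.mono_neutral_left) (auto simp: legendre_coeff_eq_0)

lemma delannoy_recurrence:
  "(int n + 2) * delannoy (n + 2) + (int n + 1) * delannoy n = 3 * (2 * int n + 3) * delannoy (n + 1)"
proof -
  let ?a = legendre_coeff
  \<comment> \<open>The terms for k = 0 are split off because the coefficient recurrence covers only
    positive indices. They all equal 1 and cancel, as (n+2) - (2n+3) + (n+1) = 0.\<close>
  have shift: "delannoy m = 1 + (\<Sum>k=0..n+1. ?a m (Suc k))" if "m \<le> n + 2" for m
    using delannoy_eq_sum[OF that] by (simp add: sum.atLeast0_atMost_Suc_shift del: sum.cl_ivl_Suc)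
  have "(int n + 2) * delannoy (n + 2) - (2 * int n + 3) * delannoy (n + 1) + (int n + 1) * delannoy n
      = (\<Sum>k=0..n+1. (int n + 2) * ?a (n + 2) (Suc k) - (2 * int n + 3) * ?a (n + 1) (Suc k)
           + (int n + 1) * ?a n (Suc k))"
    by (subst (1 2 3) shift)
       (simp_all add: sum.distrib sum_subtractf sum_distrib_left algebra_simps del: sum.cl_ivl_Suc)
  also have "\<dots> = (\<Sum>k=0..n+1. 2 * (2 * int n + 3) * ?a (n + 1) k)"
    by (intro sum.cong refl legendre_coeff_recurrence)
  also have "\<dots> = 2 * (2 * int n + 3) * delannoy (n + 1)"
    by (simp only: delannoy_def sum_distrib_left)
  finally show ?thesis
    by (simp add: algebra_simps)
qed

section \<open>First-order recurrence for the numbers \<open>R n\<close>\<close>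

definition R_term :: "nat \<Rightarrow> nat \<Rightarrow> int" where
  "R_term n k = int ((n + k) choose (2 * k)) * (int ((2 * k) choose k) div (2 * int k - 1))"

text \<open>The division is exact. Later arguments use this relation in place of \<open>div\<close>:
  they multiply by the odd number 2k - 1 and cancel it at the end.\<close>

lemma R_term_mult: "(2 * int k - 1) * R_term n k = legendre_coeff n k"
  unfolding R_term_def legendre_coeff_def
  by (simp add: odd_dvd_central_binomial mult.left_commute)

lemma two_k_minus_1_neq_0: "2 * int k - 1 \<noteq> 0"
  by presburger

lemma R_eq_sum:
  assumes "n \<le> m"
  shows "R n = (\<Sum>k=0..m. R_term n k)"
  unfolding R_def R_term_def using assms
  by (intro sum.mono_neutral_left) auto

text \<open>Multiplied by 2k - 1, this is twice \<open>legendre_coeff_Suc\<close>, since (2n+1) -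
  (2k-1) = 2(n+1-k) and (2n+3) + (2k-1) = 2(n+1+k).\<close>

lemma R_term_Suc:
  "(2 * int n + 1) * R_term (Suc n) k
     = (2 * int n + 3) * R_term n k + legendre_coeff (Suc n) k + legendre_coeff n k"
proof -
  have "(2 * int k - 1) * ((2 * int n + 1) * R_term (Suc n) k)
      = (2 * int n + 1) * legendre_coeff (Suc n) k"
    by (simp only: R_term_mult[symmetric] ac_simps)
  also have "\<dots> = (2 * int n + 3) * legendre_coeff n k
      + (2 * int k - 1) * (legendre_coeff (Suc n) k + legendre_coeff n k)"
    using legendre_coeff_Suc[of n k] by (simp add: algebra_simps)
  also have "(2 * int n + 3) * legendre_coeff n k = (2 * int k - 1) * ((2 * int n + 3) * R_term n k)"
    by (simp only: R_term_mult[symmetric] ac_simps)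
  finally have "(2 * int k - 1) * ((2 * int n + 1) * R_term (Suc n) k) = (2 * int k - 1) *
      ((2 * int n + 3) * R_term n k + legendre_coeff (Suc n) k + legendre_coeff n k)"
    by (simp add: algebra_simps)
  then show ?thesis
    using two_k_minus_1_neq_0[of k] by (metis mult_left_cancel)
qed

lemma R_Suc: "(2 * int n + 1) * R (Suc n) = (2 * int n + 3) * R n + delannoy (Suc n) + delannoy n"
proof -
  have "(2 * int n + 1) * R (Suc n) = (\<Sum>k=0..Suc n. (2 * int n + 1) * R_term (Suc n) k)"
    by (simp only: R_eq_sum[of "Suc n" "Suc n"] sum_distrib_left order_refl)
  also have "\<dots> = (\<Sum>k=0..Suc n. (2 * int n + 3) * R_term n k + legendre_coeff (Suc n) k + legendre_coeff n k)"
    by (simp only: R_term_Suc)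
  also have "\<dots> = (2 * int n + 3) * R n + delannoy (Suc n) + delannoy n"
    using R_eq_sum[of n "Suc n"] delannoy_eq_sum[of n "Suc n"] delannoy_eq_sum[of "Suc n" "Suc n"]
    by (simp only: sum.distrib sum_distrib_left le_SucI order_refl)
  finally show ?thesis .
qed

section \<open>Closed form of the weighted sum of squares\<close>

text \<open>The induction step as an identity over the integers: \<open>r\<close>, \<open>r'\<close>
  stand for R_n, R_(n+1), and \<open>d0\<close>, \<open>d1\<close>, \<open>d2\<close> for D_(n-1),
  D_n, D_(n+1).\<close>

lemma R_square_sum_step:
  fixes n S r r' d0 d1 d2 :: int
  assumes n: "2 * n + 1 \<noteq> 0"
    and r': "(2 * n + 1) * r' = (2 * n + 3) * r + d2 + d1"
    and d: "(n + 1) * d2 + n * d0 = 3 * (2 * n + 1) * d1"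
    and S: "8 * (2 * n + 1)\<^sup>2 * S = (16 * n ^ 4 - 8 * n\<^sup>2) * r\<^sup>2
      + (4 * n - 8 * n\<^sup>2 - 24 * n ^ 3) * r * d1 + (4 * n + 8 * n\<^sup>2 + 8 * n ^ 3) * r * d0
      + (4 * n + 7 * n\<^sup>2) * d1\<^sup>2 + (4 * n + 6 * n\<^sup>2) * d1 * d0 - n\<^sup>2 * d0\<^sup>2"
    and m: "m = n + 1"
  shows "8 * (2 * m + 1)\<^sup>2 * (S + (2 * n + 1) * r\<^sup>2) = (16 * m ^ 4 - 8 * m\<^sup>2) * r'\<^sup>2
      + (4 * m - 8 * m\<^sup>2 - 24 * m ^ 3) * r' * d2 + (4 * m + 8 * m\<^sup>2 + 8 * m ^ 3) * r' * d1
      + (4 * m + 7 * m\<^sup>2) * d2\<^sup>2 + (4 * m + 6 * m\<^sup>2) * d2 * d1 - m\<^sup>2 * d1\<^sup>2"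
    (is "?L = ?F")
proof -
  \<comment> \<open>Every \<open>d0\<close> in the form carries its own factor n, so the Delannoy
    recurrence eliminates it without division.\<close>
  define y where "y = 3 * (2 * n + 1) * d1 - (n + 1) * d2"
  have y: "n * d0 = y"
    using d by (simp add: y_def)
  have S': "8 * (2 * n + 1)\<^sup>2 * S = (16 * n ^ 4 - 8 * n\<^sup>2) * r\<^sup>2
      + (4 * n - 8 * n\<^sup>2 - 24 * n ^ 3) * r * d1 + (4 + 8 * n + 8 * n\<^sup>2) * r * y
      + (4 * n + 7 * n\<^sup>2) * d1\<^sup>2 + (4 + 6 * n) * d1 * y - y\<^sup>2"
    unfolding S y[symmetric] by (simp add: algebra_simps power_numeral_reduce)
  \<comment> \<open>The factor (2n+1)^2 lets \<open>r'\<close> occur only as (2n+1) r', which its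
    recurrence replaces.\<close>
  have "(2 * n + 1)\<^sup>2 * ?L = (2 * n + 3)\<^sup>2 * (8 * (2 * n + 1)\<^sup>2 * S) + 8 * (2 * n + 3)\<^sup>2 * (2 * n + 1) ^ 3 * r\<^sup>2"
    unfolding m by (simp add: algebra_simps power_numeral_reduce)
  also have "\<dots> = (16 * m ^ 4 - 8 * m\<^sup>2) * ((2 * n + 1) * r')\<^sup>2
      + (2 * n + 1) * ((4 * m - 8 * m\<^sup>2 - 24 * m ^ 3) * ((2 * n + 1) * r') * d2
      + (4 * m + 8 * m\<^sup>2 + 8 * m ^ 3) * ((2 * n + 1) * r') * d1)
      + (2 * n + 1)\<^sup>2 * ((4 * m + 7 * m\<^sup>2) * d2\<^sup>2 + (4 * m + 6 * m\<^sup>2) * d2 * d1 - m\<^sup>2 * d1\<^sup>2)"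
    unfolding S' r' m y_def by (simp add: algebra_simps power_numeral_reduce)
  also have "\<dots> = (2 * n + 1)\<^sup>2 * ?F"
    by (simp add: algebra_simps power_numeral_reduce)
  finally show ?thesis
    using n by simp
qed

text \<open>Found by fitting an ansatz: a quadratic form with polynomial coefficients.\<close>

lemma R_square_sum:
  fixes m :: nat
  defines "n \<equiv> int m + 1"
  shows "8 * (2 * n + 1)\<^sup>2 * (\<Sum>k=0..m. (2 * int k + 1) * (R k)\<^sup>2)
    = (16 * n ^ 4 - 8 * n\<^sup>2) * (R (Suc m))\<^sup>2
      + (4 * n - 8 * n\<^sup>2 - 24 * n ^ 3) * R (Suc m) * delannoy (Suc m)
      + (4 * n + 8 * n\<^sup>2 + 8 * n ^ 3) * R (Suc m) * delannoy m
      + (4 * n + 7 * n\<^sup>2) * (delannoy (Suc m))\<^sup>2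
      + (4 * n + 6 * n\<^sup>2) * delannoy (Suc m) * delannoy m - n\<^sup>2 * (delannoy m)\<^sup>2"
  unfolding n_def
proof (induction m)
  case 0
  have "R 0 = -1" "delannoy 0 = 1" "delannoy (Suc 0) = 3"
    by (simp_all add: R_def delannoy_def legendre_coeff_eq)
  moreover from this have "R (Suc 0) = 1"
    using R_Suc[of 0] by simp
  ultimately show ?case
    by simp
next
  case (Suc m)
  have "(2 * (int m + 1) + 1) * R (Suc (Suc m))
      = (2 * (int m + 1) + 3) * R (Suc m) + delannoy (Suc (Suc m)) + delannoy (Suc m)"
    using R_Suc[of "Suc m"] by (simp add: algebra_simps)
  moreover have "(int m + 1 + 1) * delannoy (Suc (Suc m)) + (int m + 1) * delannoy m
      = 3 * (2 * (int m + 1) + 1) * delannoy (Suc m)"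
    using delannoy_recurrence[of m] by (simp add: algebra_simps)
  moreover have "(\<Sum>k=0..Suc m. (2 * int k + 1) * (R k)\<^sup>2)
      = (\<Sum>k=0..m. (2 * int k + 1) * (R k)\<^sup>2) + (2 * (int m + 1) + 1) * (R (Suc m))\<^sup>2"
    by (simp add: algebra_simps)
  ultimately show ?case
    using R_square_sum_step[OF _ _ _ Suc.IH, of "R (Suc (Suc m))" "delannoy (Suc (Suc m))" "int (Suc m) + 1"]
    by (simp only:) simp
qed

section \<open>Parity and divisibility by n\<close>

text \<open>For k > 0 the central binomial coefficient is even, so the term 1 at k = 0 decides the
  parity.\<close>

lemma odd_delannoy: "odd (delannoy n)"
proof -
  have "even (legendre_coeff n (Suc k))" for k
  proof -
    have "(2 * Suc k) choose (Suc k) = 2 * ((2 * k + 1) choose k)"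
      using binomial_symmetric[of k "2 * k + 1"] by simp
    then show ?thesis
      by (simp add: legendre_coeff_def)
  qed
  then have "even (\<Sum>k=1..n. legendre_coeff n k)"
    by (intro dvd_sum) (metis Suc_pred atLeastAtMost_iff less_eq_Suc_le One_nat_def)
  then show ?thesis
    by (simp add: delannoy_def sum.atLeast_Suc_atMost)
qed

lemma odd_R: "odd (R n)"
proof (induction n)
  case 0
  then show ?case by (simp add: R_def)
next
  case (Suc n)
  have "odd ((2 * int n + 1) * R (Suc n))"
    unfolding R_Suc using Suc.IH odd_delannoy[of n] odd_delannoy[of "Suc n"] by simp
  then show ?case by simp
qed

text \<open>The form is the right-hand side of \<open>R_square_sum\<close> with one factor n
  removed. Odd squares are 1 modulo 8, which disposes of \<open>d1\<close> and \<open>d0\<close>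
  squared.\<close>

lemma even_cofactor_dvd_8:
  fixes n r d1 d0 :: int
  assumes "even n" "odd r" "odd d1" "odd d0"
  shows "8 dvd (16 * n ^ 3 - 8 * n) * r\<^sup>2
    + (4 - 8 * n - 24 * n\<^sup>2) * r * d1 + (4 + 8 * n + 8 * n\<^sup>2) * r * d0
    + (4 + 7 * n) * d1\<^sup>2 + (4 + 6 * n) * d1 * d0 - n * d0\<^sup>2"
proof -
  obtain m u x y where n: "n = 2 * m" and r: "r = 2 * u + 1" and x: "d1 = 2 * x + 1" and y: "d0 = 2 * y + 1"
    using assms by (metis evenE oddE)
  have "even (x * (x + 1))" "even (y * (y + 1))"
    by simp_all
  then obtain x' y' where x': "x * (x + 1) = 2 * x'" and y': "y * (y + 1) = 2 * y'"
    by (metis evenE)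
  have x2: "d1\<^sup>2 = 8 * x' + 1" and y2: "d0\<^sup>2 = 8 * y' + 1"
    using x' y' by (simp_all add: x y power2_eq_square algebra_simps)
  \<comment> \<open>The quotient is explicit: 4r(d1 + d0) = 8r(x + y + 1), and the constants 4 + 4
    and 7n + 6n - n = 24m give 8(1 + 3m).\<close>
  have "(16 * n ^ 3 - 8 * n) * r\<^sup>2
    + (4 - 8 * n - 24 * n\<^sup>2) * r * d1 + (4 + 8 * n + 8 * n\<^sup>2) * r * d0
    + (4 + 7 * n) * (8 * x' + 1) + (4 + 6 * n) * d1 * d0 - n * (8 * y' + 1)
    = 8 * ((2 * n ^ 3 - n) * r\<^sup>2 - (n + 3 * n\<^sup>2) * r * d1 + (n + n\<^sup>2) * r * d0
       + (r * (x + y + 1)) + (4 + 7 * n) * x' - n * y' + 1 + 3 * m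
       + (2 * x * y + x + y) + m * (6 * x * y + 3 * x + 3 * y))"
    unfolding n x y r by (simp add: algebra_simps power_numeral_reduce)
  then show ?thesis
    unfolding x2 y2 by simp
qed

lemma dvd_R_square_sum: "int (Suc m) dvd (\<Sum>k=0..m. (2 * int k + 1) * (R k)\<^sup>2)"
    (is "_ dvd ?S")
proof -
  define n where "n = int m + 1"
  define Q where "Q = (16 * n ^ 3 - 8 * n) * (R (Suc m))\<^sup>2
    + (4 - 8 * n - 24 * n\<^sup>2) * R (Suc m) * delannoy (Suc m)
    + (4 + 8 * n + 8 * n\<^sup>2) * R (Suc m) * delannoy m
    + (4 + 7 * n) * (delannoy (Suc m))\<^sup>2 + (4 + 6 * n) * delannoy (Suc m) * delannoy m
    - n * (delannoy m)\<^sup>2"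
  have eq: "8 * (2 * n + 1)\<^sup>2 * ?S = n * Q"
    using R_square_sum[of m] unfolding n_def[symmetric] Q_def
    by (simp add: algebra_simps power_numeral_reduce)
  have cop: "coprime n ((2 * n + 1)\<^sup>2)"
  proof -
    have "coprime n (2 * n + 1)"
      by (rule coprimeI) (metis dvd_add_right_iff dvd_mult)
    then show ?thesis by simp
  qed
  have "n dvd (2 * n + 1)\<^sup>2 * ?S"
  proof (cases "even n")
    case True
    then obtain Q' where "Q = 8 * Q'"
      using even_cofactor_dvd_8[OF True odd_R odd_delannoy odd_delannoy] unfolding Q_def dvd_def by blast
    with eq have "8 * ((2 * n + 1)\<^sup>2 * ?S) = 8 * (n * Q')"
      by (simp only: ac_simps)
    then show ?thesis by simp
  next
    case False
    then have "coprime n (2 ^ 3)"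
      by (simp only: coprime_power_right_iff coprime_right_2_iff_odd simp_thms)
    moreover have "n dvd 2 ^ 3 * ((2 * n + 1)\<^sup>2 * ?S)"
      using eq by (simp add: mult.assoc)
    ultimately show ?thesis
      using coprime_dvd_mult_right_iff by blast
  qed
  then have "n dvd ?S"
    using cop coprime_dvd_mult_right_iff by blast
  then show ?thesis
    by (simp add: n_def add.commute)
qed

section \<open>Central binomial coefficient and Delannoy numbers at an odd prime\<close>

context
  fixes p :: nat
  assumes p: "prime p" "odd p"
begin

lemma prime_dvd_legendre_coeff:
  assumes "0 < k" "k < p"
  shows "int p dvd legendre_coeff p k"
  using dvd_choose_prime[of k p] assms p unfolding legendre_coeff_eq
  by (simp add: dvd_mult2)

lemma coprime_prime_less: "0 < k \<Longrightarrow> k < p \<Longrightarrow> coprime (int k) (int p)"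
  using p by (metis coprime_commute coprime_int_iff nat_dvd_not_less prime_imp_coprime_nat)

lemma sum_prime_split: "(\<Sum>k=0..p. f k) = f 0 + (\<Sum>k\<in>{0<..<p}. f k) + f p" for f :: "nat \<Rightarrow> 'a :: comm_monoid_add"
proof -
  have "{0..p} = insert 0 (insert p {0<..<p})"
    using p by (auto simp: prime_gt_0_nat)
  then show ?thesis
    using p by (simp add: prime_gt_0_nat ac_simps)
qed

text \<open>By Vandermonde the coefficient is a sum of squares of \<open>p choose k\<close>; the
  inner squares vanish modulo p^2 and the two ends give 2.\<close>

lemma central_binomial_prime: "[legendre_coeff p p = 2] (mod (int p)\<^sup>2)"
proof -
  have "(2 * p) choose p = (\<Sum>k\<le>p. (p choose k)\<^sup>2)"
    using choose_square_sum[of p] by simp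
  also have "\<dots> = 2 + (\<Sum>k\<in>{0<..<p}. (p choose k)\<^sup>2)"
    by (simp add: atMost_atLeast0 sum_prime_split)
  finally have "legendre_coeff p p = 2 + int (\<Sum>k\<in>{0<..<p}. (p choose k)\<^sup>2)"
    by (simp add: legendre_coeff_eq mult_2)
  moreover have "p\<^sup>2 dvd (\<Sum>k\<in>{0<..<p}. (p choose k)\<^sup>2)"
    using p by (intro dvd_sum dvd_power_same dvd_choose_prime) auto
  then have "(int p)\<^sup>2 dvd int (\<Sum>k\<in>{0<..<p}. (p choose k)\<^sup>2)"
    by (metis int_dvd_int_iff of_nat_power)
  ultimately show ?thesis
    by (simp add: cong_iff_dvd_diff)
qed

lemma delannoy_prime: "[delannoy p = 3] (mod int p)"
proof -
  have "[legendre_coeff p p = 2] (mod int p)"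
    using central_binomial_prime by (rule cong_dvd_modulus) simp
  moreover have "[(\<Sum>k\<in>{0<..<p}. legendre_coeff p k) = 0] (mod int p)"
    using prime_dvd_legendre_coeff by (auto simp: cong_0_iff intro!: dvd_sum)
  ultimately have "[1 + (\<Sum>k\<in>{0<..<p}. legendre_coeff p k) + legendre_coeff p p = 1 + 0 + 2] (mod int p)"
    by (intro cong_add cong_refl)
  then show ?thesis
    by (simp add: delannoy_def sum_prime_split)
qed

text \<open>For 0 < k < p the two coefficients add up to 2p/(p+k) times
  \<open>legendre_coeff p k\<close>, which supplies a second factor p. The ends k = 0 and k = p
  contribute 2 each.\<close>

lemma delannoy_prime_add: "[delannoy p + delannoy (p - 1) = 4] (mod (int p)\<^sup>2)"
proof -
  define f where "f k = legendre_coeff p k + legendre_coeff (p - 1) k" for k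
  have f: "(int p + int k) * f k = 2 * int p * legendre_coeff p k" for k
  proof -
    have "Suc (p - 1) = p" "int (p - 1) + 1 = int p"
      using prime_gt_0_nat[OF p(1)] by simp_all
    then show ?thesis
      using legendre_coeff_Suc[of "p - 1" k] by (simp add: f_def algebra_simps)
  qed
  have "(int p)\<^sup>2 dvd f k" if k: "0 < k" "k < p" for k
  proof -
    have "(int p)\<^sup>2 dvd (int p + int k) * f k"
      unfolding f using prime_dvd_legendre_coeff[OF k] by (auto simp: power2_eq_square)
    moreover have "coprime ((int p)\<^sup>2) (int p + int k)"
    proof -
      have "coprime (int p) (int k + int p)"
        using coprime_prime_less[OF k] by (metis coprime_iff_gcd_eq_1 gcd.commute gcd_add1)
      then show ?thesis by (simp add: add.commute)
    qed
    ultimately show ?thesis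
      using coprime_dvd_mult_right_iff by blast
  qed
  then have "[(\<Sum>k\<in>{0<..<p}. f k) = 0] (mod (int p)\<^sup>2)"
    by (auto simp: cong_0_iff intro!: dvd_sum)
  moreover have "[f p = 2] (mod (int p)\<^sup>2)"
    using central_binomial_prime p by (simp add: f_def legendre_coeff_eq_0 prime_gt_0_nat)
  ultimately have "[2 + (\<Sum>k\<in>{0<..<p}. f k) + f p = 2 + 0 + 2] (mod (int p)\<^sup>2)"
    by (intro cong_add cong_refl)
  moreover have "delannoy p + delannoy (p - 1) = 2 + (\<Sum>k\<in>{0<..<p}. f k) + f p"
    using sum_prime_split[of f] delannoy_eq_sum[of "p - 1" p] delannoy_eq_sum[of p p]
    by (simp add: f_def sum.distrib)
  ultimately show ?thesis
    by simp
qed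

section \<open>The value of R_p + D_p modulo p^2\<close>

text \<open>With j = k + 1, the induction step produces (p-j)(p+j) = p^2 - j^2 next to a factor p,
  so modulo p^3 only -j^2 survives; j^2 is then cancelled.\<close>

lemma legendre_coeff_prime_cong:
  assumes "k < p"
  shows "[(int k + 1)\<^sup>2 * legendre_coeff p (Suc k) = int p * (int p + int k + 1) * (-1) ^ k] (mod (int p) ^ 3)"
  using assms
proof (induction k)
  case 0
  show ?case
    using legendre_coeff_Suc_right[of 0 p] by simp
next
  case (Suc k)
  let ?a = "legendre_coeff p" and ?q = "int p" and ?j = "int k + 1"
  have "[(?q - ?j) * (?q + ?j + 1) * (?j\<^sup>2 * ?a (Suc k)) = (?q - ?j) * (?q + ?j + 1) * (?q * (?q + ?j) * (-1) ^ k)] (mod ?q ^ 3)"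
    using Suc by (intro cong_mult[OF cong_refl]) (simp add: add.assoc)
  also have "(?q - ?j) * (?q + ?j + 1) * (?q * (?q + ?j) * (-1) ^ k)
      = ?j\<^sup>2 * (?q * (?q + ?j + 1) * (-1) ^ Suc k) + ?q ^ 3 * ((?q + ?j + 1) * (-1) ^ k)"
    by (simp add: algebra_simps power_numeral_reduce)
  also have "[\<dots> = ?j\<^sup>2 * (?q * (?q + ?j + 1) * (-1) ^ Suc k) + 0] (mod ?q ^ 3)"
    by (intro cong_add cong_refl) (simp add: cong_0_iff)
  finally have "[?j\<^sup>2 * ((?q - ?j) * (?q + ?j + 1) * ?a (Suc k)) = ?j\<^sup>2 * (?q * (?q + ?j + 1) * (-1) ^ Suc k)] (mod ?q ^ 3)"
    by (simp add: ac_simps)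
  moreover have "coprime (?j\<^sup>2) (?q ^ 3)"
    using coprime_prime_less[of "Suc k"] Suc.prems by (simp add: add.commute)
  ultimately have "[(?q - ?j) * (?q + ?j + 1) * ?a (Suc k) = ?q * (?q + ?j + 1) * (-1) ^ Suc k] (mod ?q ^ 3)"
    using cong_mult_lcancel by blast
  moreover have "(?q - ?j) * (?q + ?j + 1) * ?a (Suc k) = (int (Suc k) + 1)\<^sup>2 * ?a (Suc (Suc k))"
    using legendre_coeff_Suc_right[of "Suc k" p] by (simp add: algebra_simps)
  ultimately show ?case
    by (simp add: algebra_simps)
qed

text \<open>As 0 < 2k - 1 < 2p, the prime could divide 2k - 1 only if 2k - 1 = p, the excluded
  middle index.\<close>

lemma coprime_two_k_minus_1:
  assumes "0 < k" "k \<le> p" "2 * k \<noteq> p + 1"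
  shows "coprime (2 * int k - 1) (int p)"
proof -
  have "\<not> p dvd 2 * k - 1"
  proof
    assume "p dvd 2 * k - 1"
    then obtain c where c: "2 * k - 1 = p * c" by (elim dvdE)
    have "c \<noteq> 1" using c assms by auto
    moreover have "c \<noteq> 0" using c assms by (cases c) auto
    ultimately have "p * 2 \<le> p * c" by simp
    then show False using c assms by linarith
  qed
  then have "coprime (int (2 * k - 1)) (int p)"
    using p by (metis coprime_commute coprime_int_iff prime_imp_coprime_nat)
  then show ?thesis
    using assms by (simp add: of_nat_diff)
qed

text \<open>The product \<open>2 * int k * R_term p k\<close> is the k-th term of R_p + D_p, because
  1 + (2k - 1) = 2k.\<close>

lemma R_term_prime_cong:
  assumes "0 < k" "k < p"
  shows "[(2 * int k - 1) * (2 * int k * R_term p k) = 2 * int p * (-1) ^ (k - 1)] (mod (int p)\<^sup>2)"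
proof -
  obtain j where j: "k = Suc j" using assms by (cases k) auto
  have "[(int k)\<^sup>2 * legendre_coeff p k = int p * (int p + int k) * (-1) ^ j] (mod (int p) ^ 3)"
    using legendre_coeff_prime_cong[of j] assms unfolding j by (simp add: ac_simps)
  then have "[(int k)\<^sup>2 * legendre_coeff p k = int p * (int p + int k) * (-1) ^ j] (mod (int p)\<^sup>2)"
    by (rule cong_dvd_modulus) (simp add: le_imp_power_dvd)
  moreover have "[int p * (int p + int k) * (-1) ^ j = int k * (int p * (-1) ^ j)] (mod (int p)\<^sup>2)"
    unfolding cong_iff_dvd_diff by (simp add: algebra_simps power2_eq_square)
  ultimately have "[int k * (int k * legendre_coeff p k) = int k * (int p * (-1) ^ j)] (mod (int p)\<^sup>2)"
    unfolding power2_eq_square[of "int k"] mult.assoc by (rule cong_trans)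
  then have "[int k * legendre_coeff p k = int p * (-1) ^ j] (mod (int p)\<^sup>2)"
    using coprime_prime_less[OF assms] by (subst (asm) cong_mult_lcancel) simp_all
  then have "[2 * (int k * legendre_coeff p k) = 2 * (int p * (-1) ^ j)] (mod (int p)\<^sup>2)"
    by (rule cong_mult[OF cong_refl])
  moreover have "2 * (int k * legendre_coeff p k) = (2 * int k - 1) * (2 * int k * R_term p k)"
    by (simp only: R_term_mult[symmetric] ac_simps)
  ultimately show ?thesis
    using j by (simp add: mult.assoc)
qed

text \<open>For l = p + 1 - k the factors 2k - 1 and 2l - 1 add up to 2p, while the signs in
  \<open>R_term_prime_cong\<close> agree because p is odd. Hence the two terms are opposite.\<close>

lemma R_term_prime_reflect:
  assumes "1 < k" "k < p" "2 * k \<noteq> p + 1"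
  shows "(int p)\<^sup>2 dvd 2 * int k * R_term p k + 2 * int (p + 1 - k) * R_term p (p + 1 - k)"
proof -
  define l where "l = p + 1 - k"
  define u where "u i = 2 * int i * R_term p i" for i
  have l: "0 < l" "l < p" "2 * l \<noteq> p + 1" "int l = int p + 1 - int k"
    using assms by (auto simp: l_def of_nat_diff)
  have "even (k - 1) \<longleftrightarrow> even (l - 1)"
    using assms p(2) by (simp add: l_def)
  then have sgn: "(-1 :: int) ^ (l - 1) = (-1) ^ (k - 1)"
    by (cases "even (k - 1)") auto
  \<comment> \<open>Divisibility of \<open>u l\<close> by p makes the correction 2p * u l vanish
    modulo p^2.\<close>
  have "int p dvd (2 * int l - 1) * u l"
    using prime_dvd_legendre_coeff[OF l(1,2)] R_term_mult[of l p]
    by (simp add: u_def mult.left_commute)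
  then have "int p dvd u l"
    using coprime_two_k_minus_1[of l] l coprime_dvd_mult_right_iff coprime_commute by (metis less_imp_le)
  then have "[2 * int p * u l = 0] (mod (int p)\<^sup>2)"
    by (simp add: cong_0_iff power2_eq_square mult.assoc)
  with R_term_prime_cong[of k] R_term_prime_cong[OF l(1,2)] assms
  have "[(2 * int k - 1) * u k + 2 * int p * u l - (2 * int l - 1) * u l
      = 2 * int p * (-1) ^ (k - 1) + 0 - 2 * int p * (-1) ^ (l - 1)] (mod (int p)\<^sup>2)"
    unfolding u_def by (intro cong_add cong_diff) simp_all
  moreover have "(2 * int k - 1) * u k + 2 * int p * u l - (2 * int l - 1) * u l = (2 * int k - 1) * (u k + u l)"
    unfolding l(4) by (simp add: algebra_simps)
  ultimately have "(int p)\<^sup>2 dvd (2 * int k - 1) * (u k + u l)"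
    using sgn by (simp add: cong_0_iff)
  moreover have "coprime ((int p)\<^sup>2) (2 * int k - 1)"
    using coprime_two_k_minus_1[of k] assms by (simp add: coprime_commute)
  ultimately show ?thesis
    unfolding u_def l_def using coprime_dvd_mult_right_iff by blast
qed

text \<open>Here 2h - 1 = p, so the division costs one factor p; this is why the coefficients are
  needed modulo p^3.\<close>

lemma R_term_prime_middle:
  defines "h \<equiv> (p + 1) div 2"
  shows "[2 * int h * R_term p h = 2 * (1 + 2 * int p) * (-1) ^ ((p - 1) div 2)] (mod (int p)\<^sup>2)"
proof -
  define e :: int where "e = (-1) ^ ((p - 1) div 2)"
  define j where "j = (p - 1) div 2"
  have pj: "p = 2 * j + 1" and h: "h = j + 1"
    using p(2) by (auto simp: j_def h_def elim!: oddE)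
  have j: "j < p" and h2: "2 * int h = int p + 1" "2 * int h - 1 = int p" "int h = int j + 1"
    using pj h by simp_all
  have r: "int p * R_term p h = legendre_coeff p h"
    using R_term_mult[of h p] by (simp only: h2(2))
  have "[(int h)\<^sup>2 * legendre_coeff p h = int p * (int p + int h) * e] (mod (int p) ^ 3)"
    using legendre_coeff_prime_cong[OF j] unfolding e_def j_def[symmetric] h by (simp add: ac_simps)
  then have "(int p * (int p)\<^sup>2) dvd (int p * ((int h)\<^sup>2 * R_term p h - (int p + int h) * e))"
    unfolding r[symmetric] cong_iff_dvd_diff by (simp add: algebra_simps power_numeral_reduce)
  moreover have "int p \<noteq> 0"
    using pj by simp
  ultimately have "(int p)\<^sup>2 dvd (int h)\<^sup>2 * R_term p h - (int p + int h) * e"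
    by (simp only: dvd_mult_cancel_left) blast
  \<comment> \<open>The added multiple of p^2 completes 4(p + h) = 6p + 2 to 2(p+1)(2p+1), so that p
    + 1 = 2h can be cancelled.\<close>
  then have "(int p)\<^sup>2 dvd 4 * ((int h)\<^sup>2 * R_term p h - (int p + int h) * e) + (int p)\<^sup>2 * (- 4 * e)"
    by (intro dvd_add dvd_mult dvd_triv_left)
  also have "4 * ((int h)\<^sup>2 * R_term p h - (int p + int h) * e) + (int p)\<^sup>2 * (- 4 * e)
      = (int p + 1) * (2 * int h * R_term p h - 2 * (1 + 2 * int p) * e)"
    using h2(1) pj h by (simp add: algebra_simps power_numeral_reduce)
  finally have "(int p)\<^sup>2 dvd (int p + 1) * (2 * int h * R_term p h - 2 * (1 + 2 * int p) * e)" .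
  moreover have "coprime ((int p)\<^sup>2) (int p + 1)"
    by simp
  ultimately show ?thesis
    unfolding cong_iff_dvd_diff e_def using coprime_dvd_mult_right_iff by blast
qed

lemma R_prime_add_delannoy:
  "[R p + delannoy p = 2 * (1 + 2 * int p) * (-1) ^ ((p - 1) div 2) - 2 * int p] (mod (int p)\<^sup>2)"
proof -
  define u where "u k = 2 * int k * R_term p k" for k
  define h where "h = (p + 1) div 2"
  \<comment> \<open>The indices paired by k -> p + 1 - k, without the fixed point h and without the
    pair 1, p, whose terms do not cancel.\<close>
  define A where "A = {1<..<p} - {h}"
  have p3: "3 \<le> p"
    using p prime_ge_2_nat[of p] by (cases "p = 2") auto
  have h: "2 * h = p + 1" "1 < h" "h < p"
    using p(2) p3 by (auto simp: h_def elim!: oddE)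
  have split: "{0<..<p} = insert 1 (insert h A)"
    using h by (auto simp: A_def)
  have "R p + delannoy p = (\<Sum>k=0..p. u k)"
    unfolding R_eq_sum[OF order_refl] delannoy_def sum.distrib[symmetric] R_term_mult[symmetric] u_def
    by (simp add: algebra_simps)
  also have "\<dots> = (\<Sum>k\<in>{0<..<p}. u k) + u p"
    by (simp add: sum_prime_split u_def)
  also have "(\<Sum>k\<in>{0<..<p}. u k) = u 1 + (u h + sum u A)"
  proof -
    have "finite A" "h \<notin> A" "1 \<notin> insert h A"
      using h by (auto simp: A_def)
    then show ?thesis
      unfolding split by simp
  qed
  finally have eq: "R p + delannoy p = u 1 + (u h + sum u A) + u p" .
  have "bij_betw (\<lambda>k. p + 1 - k) A A"
    using h by (intro bij_betwI[where g = "\<lambda>k. p + 1 - k"]) (auto simp: A_def)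
  then have "sum u A = (\<Sum>k\<in>A. u (p + 1 - k))"
    by (rule sum.reindex_bij_betw[symmetric])
  \<comment> \<open>Each pair is counted twice; the factor 2 is invertible since p is odd.\<close>
  then have "2 * sum u A = (\<Sum>k\<in>A. u k + u (p + 1 - k))"
    by (simp add: sum.distrib)
  moreover have "(int p)\<^sup>2 dvd (\<Sum>k\<in>A. u k + u (p + 1 - k))"
    using R_term_prime_reflect h unfolding u_def by (intro dvd_sum) (auto simp: A_def)
  ultimately have "(int p)\<^sup>2 dvd 2 * sum u A"
    by simp
  moreover have "coprime ((int p)\<^sup>2) 2"
    using p(2) by simp
  ultimately have "(int p)\<^sup>2 dvd sum u A"
    using coprime_dvd_mult_right_iff by blast
  then have A: "[sum u A = 0] (mod (int p)\<^sup>2)"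
    by (simp add: cong_0_iff)
  have "u 1 = 2 * int p * (int p + 1)"
    using R_term_mult[of 1 p] legendre_coeff_Suc_right[of 0 p] by (simp add: u_def)
  then have 1: "[u 1 = 2 * int p] (mod (int p)\<^sup>2)"
    by (simp add: cong_iff_dvd_diff algebra_simps power2_eq_square)
  \<comment> \<open>The value -4p arises because (2p-1) u p = 2p * \<open>legendre_coeff p p\<close>
    is 4p modulo p^2, and so is (2p-1)(-4p).\<close>
  have "(2 * int p - 1) * (u p - (- 4 * int p)) = 2 * int p * (legendre_coeff p p - 2) + (int p)\<^sup>2 * 8"
    unfolding u_def R_term_mult[symmetric] by (simp add: algebra_simps power2_eq_square)
  moreover have "(int p)\<^sup>2 dvd \<dots>"
    using central_binomial_prime unfolding cong_iff_dvd_diff by (intro dvd_add dvd_mult dvd_triv_left)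
  ultimately have "(int p)\<^sup>2 dvd (2 * int p - 1) * (u p - (- 4 * int p))"
    by simp
  moreover have "coprime ((int p)\<^sup>2) (2 * int p - 1)"
    using coprime_two_k_minus_1[of p] p3 by (simp add: coprime_commute)
  ultimately have "[u p = - 4 * int p] (mod (int p)\<^sup>2)"
    unfolding cong_iff_dvd_diff using coprime_dvd_mult_right_iff by blast
  with 1 A R_term_prime_middle have "[u 1 + (u h + sum u A) + u p
      = 2 * int p + (2 * (1 + 2 * int p) * (-1) ^ ((p - 1) div 2) + 0) + - 4 * int p] (mod (int p)\<^sup>2)"
    unfolding u_def h_def by (intro cong_add)
  then show ?thesis
    unfolding eq by (simp add: algebra_simps)
qed

section \<open>The sum modulo p^3\<close>

lemma R_square_sum_prime:
  "[(\<Sum>k=0..p-1. (2 * int k + 1) * (R k)\<^sup>2)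
      = 4 * int p * (-1) ^ ((p - 1) div 2) - (int p)\<^sup>2] (mod (int p) ^ 3)"
    (is "[?S = _] (mod _)")
proof -
  define q where "q = int p"
  define e :: int where "e = (-1) ^ ((p - 1) div 2)"
  define r d1 d0 where "r = R p" and "d1 = delannoy p" and "d0 = delannoy (p - 1)"
  have e2: "e * e = 1"
    unfolding e_def by (simp flip: power_add mult_2)
  have "Suc (p - 1) = p" "int (p - 1) + 1 = q"
    using prime_gt_0_nat[OF p(1)] by (simp_all add: q_def)
  then have S: "8 * (2 * q + 1)\<^sup>2 * ?S = (16 * q ^ 4 - 8 * q\<^sup>2) * r\<^sup>2
      + (4 * q - 8 * q\<^sup>2 - 24 * q ^ 3) * r * d1 + (4 * q + 8 * q\<^sup>2 + 8 * q ^ 3) * r * d0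
      + (4 * q + 7 * q\<^sup>2) * d1\<^sup>2 + (4 * q + 6 * q\<^sup>2) * d1 * d0 - q\<^sup>2 * d0\<^sup>2"
    using R_square_sum[of "p - 1"] by (simp add: r_def d1_def d0_def)
  obtain x where x: "d1 = 3 + q * x"
    using delannoy_prime by (metis cong_iff_lin cong_sym d1_def q_def)
  obtain y where y: "d1 + d0 = 4 + q\<^sup>2 * y"
    using delannoy_prime_add by (metis cong_iff_lin cong_sym d1_def d0_def q_def)
  obtain z where z: "r + d1 = 2 * (1 + 2 * q) * e - 2 * q + q\<^sup>2 * z"
    using R_prime_add_delannoy by (metis cong_iff_lin cong_sym d1_def r_def q_def e_def)
  define r1 where "r1 = 4 * e - 2 + q * z - x"
  define y1 where "y1 = q * y - x"
  have r: "r = 2 * e - 3 + q * r1"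
    using x z by (simp add: r1_def algebra_simps power2_eq_square)
  have d0: "d0 = 1 + q * y1"
    using x y by (simp add: y1_def algebra_simps power2_eq_square)
  \<comment> \<open>The closed form is sorted by powers of q. The linear part is 4q(r + d1)(d1 +
    d0), where both sums are known modulo q^2; \<open>U\<close> is the coefficient of q^2 and
    matters only modulo q.\<close>
  define U where "U = - 8 * r\<^sup>2 - 8 * r * d1 + 8 * r * d0 + 7 * d1\<^sup>2 + 6 * d1 * d0 - d0\<^sup>2"
  have "[U = - 8 * (2 * e - 3)\<^sup>2 - 8 * (2 * e - 3) * 3 + 8 * (2 * e - 3) * 1 + 7 * 3\<^sup>2 + 6 * 3 * 1 - 1\<^sup>2] (mod q)"
    unfolding U_def r x d0
    by (intro cong_add cong_diff cong_mult cong_pow cong_refl) (simp_all add: cong_iff_dvd_diff)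
  also have "- 8 * (2 * e - 3)\<^sup>2 - 8 * (2 * e - 3) * 3 + 8 * (2 * e - 3) * 1 + 7 * 3\<^sup>2 + 6 * 3 * 1 - 1\<^sup>2 = 24 + 64 * e"
    by (simp add: algebra_simps power2_eq_square e2)
  finally obtain v where v: "U = 24 + 64 * e + q * v"
    by (metis cong_iff_lin cong_sym)
  have "8 * (2 * q + 1)\<^sup>2 * ?S = 4 * q * ((r + d1) * (d1 + d0)) + q\<^sup>2 * U
      + q ^ 3 * (16 * q * r\<^sup>2 - 24 * r * d1 + 8 * r * d0)"
    unfolding S U_def by (simp add: algebra_simps power_numeral_reduce)
  \<comment> \<open>Modulo q^3 both sides are 32qe + (128e - 8)q^2; the bracket after q^3 collects
    the remainder.\<close>
  also have "\<dots> = 8 * (2 * q + 1)\<^sup>2 * (4 * q * e - q\<^sup>2) + q ^ 3 * (16 * q * r\<^sup>2 - 24 * r * d1 + 8 * r * d0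
      + v + 4 * ((2 * (1 + 2 * q) * e - 2 * q) * y + z * (4 + q\<^sup>2 * y)) + 32 * (1 - 4 * e + q))"
    unfolding v y z by (simp add: algebra_simps power_numeral_reduce)
  finally have "[8 * (2 * q + 1)\<^sup>2 * ?S = 8 * (2 * q + 1)\<^sup>2 * (4 * q * e - q\<^sup>2)] (mod q ^ 3)"
    by (simp add: cong_iff_dvd_diff)
  moreover have "coprime (8 * (2 * q + 1)\<^sup>2) (q ^ 3)"
  proof -
    have "coprime (2 ^ 3) q"
      using p(2) by (simp only: q_def coprime_power_left_iff coprime_left_2_iff_odd even_of_nat simp_thms)
    moreover have "coprime (2 * q + 1) q"
      by (rule coprimeI) (metis dvd_add_right_iff dvd_mult)
    ultimately show ?thesis
      by simp
  qed
  ultimately show ?thesis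
    unfolding q_def e_def using cong_mult_lcancel by blast
qed

end

theorem theorem1p1:
  fixes n p :: nat
  assumes "n > 0" and "prime p" and "odd p"
  shows "[(\<Sum>k=0..n-1. (2 * int k + 1) * (R k)\<^sup>2) = 0] (mod int n) \<and>
         [(\<Sum>k=0..p-1. (2 * int k + 1) * (R k)\<^sup>2)
            = 4 * int p * (-1) ^ ((p - 1) div 2) - (int p)\<^sup>2] (mod (int p) ^ 3)"
  using dvd_R_square_sum[of "n - 1"] R_square_sum_prime assms by (simp add: cong_0_iff)

end
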